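(* Let $k,m\geqslant1$ and $l\geqslant0$ be integers, and let ${\tt w}$ be the one-sided fixed point (starting with ${\tt a}$) of the substitution $\sigma_{k,l,m}:{\tt a}\mapsto{\tt a}^k{\tt b}{\tt a}^l,\ {\tt b}\mapsto{\tt a}^m$. Then for all $n\geqslant1$, \[p_{\tt b}(n)=m\, p_{\tt a}(n)+(k+l+1-m)n+m-l-1,\] and in particular \[r(n)=(m-1)\,p_{\tt a}(n)+(k+l+1-m)n+m-l-1.\] Moreover, ${\tt w}$ is the unique word ${\tt w}'\in\mathcal{W}$ whose position and relative position functions satisfy $r_{{\tt w}'}(n)=(m-1)\,p_{{\tt a},{\tt w}'}(n)+(k+l+1-m)n+m-l-1$ for all $n\geqslant1$.
   Context: Words are infinite one-sided words over $\{{\tt a},{\tt b}\}$ indexed from position $0$; $\mathcal{W}$ is the set of such words in which both letters occur infinitely often. For ${\tt w}\in\mathcal{W}$ and $n\geqslant1$, $p_{\tt a}(n)=p_{{\tt a},{\tt w}}(n)$ (resp. $p_{\tt b}(n)$) is the position of the $n$-th occurrence of ${\tt a}$ (resp. ${\tt b}$) in ${\tt w}$, and $r(n)=r_{\tt w}(n)=p_{\tt b}(n)-p_{\tt a}(n)$. Here ${\tt a}^k$ denotes $k$ consecutive copies of ${\tt a}$. *)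

theory Defs
  imports "HOL-Library.Stream" "HOL-Library.Infinite_Set"
begin

datatype letter = A | B

definition words_inf_both :: "letter stream set" ("\<W>") where
  "\<W> = {w. infinite {i. w !! i = A} \<and> infinite {i. w !! i = B}}"

text \<open>Occurrences are counted from 1, positions from 0. The value is only meaningful for
  \<open>n \<ge> 1\<close> and a letter \<open>c\<close> that occurs infinitely often in \<open>w\<close>.\<close>

definition occ_pos :: "letter \<Rightarrow> letter stream \<Rightarrow> nat \<Rightarrow> nat" where
  "occ_pos c w n = enumerate {i. w !! i = c} (n - 1)"

abbreviation p\<^sub>a :: "letter stream \<Rightarrow> nat \<Rightarrow> nat" where
  "p\<^sub>a \<equiv> occ_pos A"

abbreviation p\<^sub>b :: "letter stream \<Rightarrow> nat \<Rightarrow> nat" where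
  "p\<^sub>b \<equiv> occ_pos B"

definition rel_pos :: "letter stream \<Rightarrow> nat \<Rightarrow> int" where
  "rel_pos w n = int (p\<^sub>b w n) - int (p\<^sub>a w n)"

fun sigma :: "nat \<Rightarrow> nat \<Rightarrow> nat \<Rightarrow> letter \<Rightarrow> letter list" where
  "sigma k l m A = replicate k A @ [B] @ replicate l A"
| "sigma k l m B = replicate m A"

text \<open>\<open>flat\<close> is concatenation only when all the lists are nonempty, that is, for
  non-erasing substitutions; \<open>sigma k l m\<close> is non-erasing for \<open>m \<ge> 1\<close>.\<close>

definition subst_word :: "('a \<Rightarrow> 'b list) \<Rightarrow> 'a stream \<Rightarrow> 'b stream" where
  "subst_word s w = flat (smap s w)"

definition fixed_point_from :: "('a \<Rightarrow> 'a list) \<Rightarrow> 'a \<Rightarrow> 'a stream \<Rightarrow> bool" where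
  "fixed_point_from s c w \<longleftrightarrow> shd w = c \<and> subst_word s w = w"

lemma sigma_nonempty: "m \<ge> 1 \<Longrightarrow> sigma k l m c \<noteq> []"
  by (cases c) auto

lemma subst_word_shift:
  assumes "\<And>c. s c \<noteq> []"
  shows "subst_word s (xs @- w) = concat (map s xs) @- subst_word s w"
  using assms by (induction xs) (auto simp: subst_word_def)

lemma length_concat_map_ge:
  assumes "\<And>c. s c \<noteq> []"
  shows "length (concat (map s xs)) \<ge> length xs"
proof (induction xs)
  case (Cons x xs)
  then show ?case using assms[of x] by (cases "s x") auto
qed simp

lemma stream_eq_stakeI: "(\<And>n. stake n v = stake n w) \<Longrightarrow> v = w"
  by (metis lessI stake_nth stream.map_cong0 stream_smap_nats)

lemma sigma_fixed_point_unique: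
  assumes "k \<ge> 1" "m \<ge> 1"
    and v: "fixed_point_from (sigma k l m) A v" and w: "fixed_point_from (sigma k l m) A w"
  shows "v = w"
proof -
  let ?s = "sigma k l m"
  have ne: "\<And>c. ?s c \<noteq> []" using sigma_nonempty assms(2) .
  have "stake (Suc n) v = stake (Suc n) w" for n
  proof (induction n)
    case 0
    then show ?case using v w by (simp add: fixed_point_from_def)
  next
    case (Suc n)
    define xs where "xs = stake (Suc n) v"
    define ys where "ys = concat (map ?s xs)"
    have len: "length ys \<ge> Suc (Suc n)"
    proof -
      have "xs = A # stake n (stl v)" using v by (simp add: xs_def fixed_point_from_def)
      then show ?thesis
        using length_concat_map_ge[of ?s "stake n (stl v)", OF ne] assms(1) by (simp add: ys_def)
    qed
    have "v = ys @- subst_word ?s (sdrop (Suc n) v)"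
      using v subst_word_shift[of ?s xs "sdrop (Suc n) v", OF ne]
      by (simp only: xs_def ys_def stake_sdrop fixed_point_from_def)
    moreover have "w = ys @- subst_word ?s (sdrop (Suc n) w)"
      using w subst_word_shift[of ?s xs "sdrop (Suc n) w", OF ne] Suc
      by (simp only: xs_def ys_def stake_sdrop fixed_point_from_def)
    ultimately show ?case
      using len by (metis stake_append min.absorb2 diff_is_0_eq stake.simps(1))
  qed
  then have "stake n v = stake n w" for n by (cases n) simp_all
  then show ?thesis by (rule stream_eq_stakeI)
qed

lemma sigma_fixed_point_exists:
  assumes "k \<ge> 1" "m \<ge> 1"
  shows "\<exists>w. fixed_point_from (sigma k l m) A w"
proof -
  let ?s = "sigma k l m"
  have ne: "\<And>c. ?s c \<noteq> []" using sigma_nonempty assms(2) .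
  define S where "S = (\<lambda>xs. concat (map ?s xs))"
  define u where "u n = (S ^^ n) [A]" for n
  have u0: "u 0 = [A]" and uS: "u (Suc n) = S (u n)" for n by (simp_all add: u_def)
  obtain k' where k': "k = Suc k'" using assms(1) by (cases k) auto
  have ext: "\<exists>t. t \<noteq> [] \<and> u (Suc n) = u n @ t" for n
  proof (induction n)
    case 0
    then show ?case by (auto simp: uS u0 S_def k')
  next
    case (Suc n)
    then obtain t where t: "t \<noteq> []" "u (Suc n) = u n @ t" by blast
    have "u (Suc (Suc n)) = S (u n @ t)" using t(2) uS by metis
    also have "\<dots> = u (Suc n) @ S t" by (simp add: S_def uS)
    finally have "u (Suc (Suc n)) = u (Suc n) @ S t" .
    moreover have "S t \<noteq> []" using ne t(1) by (cases t) (auto simp: S_def)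
    ultimately show ?case by blast
  qed
  have len: "length (u n) > n" for n
  proof (induction n)
    case 0
    then show ?case by (simp add: u0)
  next
    case (Suc n)
    then show ?case using ext[of n] by (auto simp: Suc_less_eq2 neq_Nil_conv)
  qed
  have pre: "\<exists>t. u (n + d) = u n @ t" for n d
  proof (induction d)
    case (Suc d)
    then show ?case using ext[of "n + d"] by auto
  qed simp
  have nth: "u n ! i = u i ! i" if "i < length (u n)" for n i
  proof (cases "n \<le> i")
    case True
    then show ?thesis using pre[of n "i - n"] that by (auto simp: nth_append)
  next
    case False
    then show ?thesis using pre[of i "n - i"] len[of i] by (auto simp: nth_append)
  qed
  define w where "w = smap (\<lambda>i. u i ! i) nats"
  have wi: "w !! i = u i ! i" for i by (simp add: w_def)
  have wu: "stake (length (u n)) w = u n" for n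
    by (rule nth_equalityI) (simp_all add: wi nth)
  have eq: "subst_word ?s w = u (Suc n) @- subst_word ?s (sdrop (length (u n)) w)" for n
    using subst_word_shift[of ?s "u n" "sdrop (length (u n)) w", OF ne] stake_sdrop[of "length (u n)" w]
    by (simp add: wu uS S_def)
  have "subst_word ?s w !! i = w !! i" for i
  proof -
    have "i < length (u (Suc i))" using len[of "Suc i"] by simp
    then show ?thesis using eq[of i] nth[of i "Suc i"] by (simp add: wi)
  qed
  then have "subst_word ?s w = w" by (metis stream.map_cong0 stream_smap_nats)
  moreover have "shd w = A" using wi[of 0] by (simp add: u0)
  ultimately show ?thesis unfolding fixed_point_from_def by blast
qed

lemma sigma_fixed_point_ex1:
  assumes "k \<ge> 1" "m \<ge> 1"
  shows "\<exists>!w. fixed_point_from (sigma k l m) A w"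
  using sigma_fixed_point_exists[OF assms] sigma_fixed_point_unique[OF assms] by blast

end

theory Submission
  imports Defs
begin

text \<open>
  In the fixed point, the \<open>n\<close>-th \<open>b\<close> is the one contributed by the image of the \<open>n\<close>-th \<open>a\<close>.
  The \<open>p\<^sub>a(n)\<close> letters before that \<open>a\<close> comprise \<open>n - 1\<close> letters \<open>a\<close> and \<open>p\<^sub>a(n) - (n - 1)\<close>
  letters \<open>b\<close>, so
  \<open>p\<^sub>b(n) = (k + l + 1) (n - 1) + m (p\<^sub>a(n) - (n - 1)) + k\<close>.
  Conversely, this formula forces \<open>p\<^sub>b(n) > p\<^sub>a(n)\<close> for every word satisfying it. Hence whether
  position \<open>i\<close> carries a \<open>b\<close> is decided by the letters before \<open>i\<close>, and the word is determined.
\<close>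

section \<open>Letter counts of prefixes and positions of occurrences\<close>

lemma count_list_stake: "count_list (stake i w) c = card {j. j < i \<and> w !! j = c}"
proof (induction i)
  case (Suc i)
  have "{j. j < Suc i \<and> w !! j = c}
      = (if w !! i = c then insert i {j. j < i \<and> w !! j = c} else {j. j < i \<and> w !! j = c})"
    by (auto simp: less_Suc_eq)
  then show ?case by (simp add: stake_Suc Suc del: stake.simps)
qed simp

lemma card_less_enumerate:
  fixes S :: "nat set"
  assumes "infinite S"
  shows "card {j. j < enumerate S n \<and> j \<in> S} = n"
proof -
  \<comment> \<open>\<open>enumerate\<close> is increasing and starts at index 0, so the elements of
    \<open>S\<close> below its value at \<open>n\<close> are exactly the values at the indices 0,
    ..., \<open>n - 1\<close>.\<close>
  have "{j. j < enumerate S n \<and> j \<in> S} = enumerate S ` {..<n}"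
    using assms
    by (auto simp: enumerate_in_set)
      (metis enumerate_Ex enumerate_mono_iff imageI lessThan_iff)
  then show ?thesis
    using assms by (simp add: card_image inj_enumerate inj_on_subset[OF _ subset_UNIV])
qed

lemma nth_occ_pos:
  assumes "infinite {i. w !! i = c}"
  shows "w !! occ_pos c w n = c"
  using enumerate_in_set[OF assms] by (simp add: occ_pos_def)

lemma count_list_stake_occ_pos:
  assumes "infinite {i. w !! i = c}"
  shows "count_list (stake (occ_pos c w n) w) c = n - 1"
  using card_less_enumerate[OF assms] by (simp add: count_list_stake occ_pos_def)

lemma occ_pos_count_list_stake:
  assumes "infinite {i. w !! i = c}" "w !! i = c"
  shows "occ_pos c w (Suc (count_list (stake i w) c)) = i"
proof -
  obtain n where "i = enumerate {i. w !! i = c} n"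
    using enumerate_Ex[OF assms(1), of i] assms(2) by (metis mem_Collect_eq)
  then show ?thesis
    using card_less_enumerate[OF assms(1)] by (simp add: count_list_stake occ_pos_def)
qed

lemma count_list_stake_A_B: "count_list (stake i w) A + count_list (stake i w) B = i"
proof (induction i)
  case (Suc i)
  then show ?case by (cases "w !! i") (simp_all add: stake_Suc del: stake.simps)
qed simp

section \<open>Images of prefixes under the substitution\<close>

lemma length_concat_map_sigma:
  "length (concat (map (sigma k l m) xs)) = (k + l + 1) * count_list xs A + m * count_list xs B"
proof (induction xs)
  case (Cons x xs)
  then show ?case by (cases x) simp_all
qed simp

lemma count_list_replicate: "count_list (replicate n x) y = (if x = y then n else 0)"
  by (induction n) auto

lemma count_list_concat_map_sigma_B:
  "count_list (concat (map (sigma k l m) xs)) B = count_list xs A"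
proof (induction xs)
  case (Cons x xs)
  then show ?case by (cases x) (simp_all add: count_list_replicate)
qed simp

text \<open>Being its own image, \<open>w\<close> contains the image of each of its letters, and
  that image starts where the image of the preceding prefix ends.\<close>

lemma fixed_point_decomp:
  assumes "\<And>c. s c \<noteq> []" and "fixed_point_from s c w"
  obtains v where "w = concat (map s (stake i w)) @- s (w !! i) @- v"
proof
  have "w = subst_word s w" using assms(2) by (simp add: fixed_point_from_def)
  also have "\<dots> = subst_word s (stake (Suc i) w @- sdrop (Suc i) w)"
    by (simp only: stake_sdrop)
  also have "\<dots> = concat (map s (stake i w)) @- s (w !! i) @- subst_word s (sdrop (Suc i) w)"
    unfolding subst_word_shift[of s, OF assms(1)] stake_Suc by simp
  finally show "w = concat (map s (stake i w)) @- s (w !! i) @- subst_word s (sdrop (Suc i) w)" .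
qed

text \<open>The offset \<open>k\<close> skips the \<open>A\<close>s in front of the single
  \<open>B\<close> in the image of \<open>A\<close>. Each earlier \<open>A\<close> has contributed
  one \<open>B\<close>, and images of \<open>B\<close> contribute none.\<close>

lemma sigma_image_of_A:
  assumes "m \<ge> 1" and w: "fixed_point_from (sigma k l m) A w" and "w !! i = A"
  defines "j \<equiv> length (concat (map (sigma k l m) (stake i w))) + k"
  shows "w !! j = B" and "count_list (stake j w) B = count_list (stake i w) A"
proof -
  define xs where "xs = concat (map (sigma k l m) (stake i w))"
  obtain v where "w = xs @- sigma k l m A @- v"
    using fixed_point_decomp[of "sigma k l m" A w i, OF sigma_nonempty[OF assms(1)] w]
    unfolding xs_def assms(3) by blast
  then have w_eq: "w = (xs @ replicate k A) @- (B ## replicate l A @- v)"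
    by simp
  have j: "j = length (xs @ replicate k A)" by (simp add: j_def xs_def)
  show "w !! j = B"
    by (subst w_eq) (simp add: j del: shift_append)
  have "stake j w = xs @ replicate k A"
    by (subst w_eq) (simp add: j stake_append del: shift_append)
  then show "count_list (stake j w) B = count_list (stake i w) A"
    by (simp add: count_list_replicate xs_def count_list_concat_map_sigma_B)
qed

lemma length_concat_map_sigma_stake_ge:
  assumes "k \<ge> 1" "m \<ge> 1"
  shows "length (concat (map (sigma k l m) (stake i w))) \<ge> i + count_list (stake i w) A"
proof -
  let ?a = "count_list (stake i w) A" and ?b = "count_list (stake i w) B"
  \<comment> \<open>The image of \<open>A\<close> has length at least 2, since \<open>k\<close> is
    positive, and that of \<open>B\<close> length at least 1.\<close>
  have "2 * ?a + 1 * ?b \<le> (k + l + 1) * ?a + m * ?b"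
    using assms by (intro add_mono mult_le_mono1) auto
  then show ?thesis
    using count_list_stake_A_B[of i w] unfolding length_concat_map_sigma by linarith
qed

section \<open>The fixed point: infinitely many occurrences of both letters, and the position
  formula\<close>

lemma sigma_fixed_point_in_words_inf_both:
  assumes "k \<ge> 1" "m \<ge> 1" and w: "fixed_point_from (sigma k l m) A w"
  shows "w \<in> \<W>"
proof -
  \<comment> \<open>If position \<open>i\<close> carries a \<open>B\<close>, the image of that
    \<open>B\<close> starts at \<open>i\<close> or later, and its first letter is
    \<open>A\<close>.\<close>
  have exA: "\<exists>j\<ge>i. w !! j = A" for i
  proof (cases "w !! i")
    case B
    define xs where "xs = concat (map (sigma k l m) (stake i w))"
    obtain v where v: "w = xs @- sigma k l m B @- v"
      using fixed_point_decomp[of "sigma k l m" A w i, OF sigma_nonempty[OF assms(2)] w]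
      unfolding xs_def B by blast
    have "w !! length xs = A"
      using assms(2) by (subst v) (cases m; simp)
    moreover have "length xs \<ge> i"
      using length_concat_map_sigma_stake_ge[OF assms(1,2), of i w l] by (simp add: xs_def)
    ultimately show ?thesis by blast
  qed auto
  \<comment> \<open>The image of an \<open>A\<close> at or after \<open>i\<close> contains a
    \<open>B\<close> that is again at or after \<open>i\<close>.\<close>
  have exB: "\<exists>j\<ge>i. w !! j = B" for i
  proof -
    obtain i' where "i' \<ge> i" "w !! i' = A" using exA by blast
    then show ?thesis
      using sigma_image_of_A(1)[OF assms(2) w, of i']
        length_concat_map_sigma_stake_ge[OF assms(1,2), of i' w l]
      by (meson add_leD1 order_trans trans_le_add1)
  qed
  show ?thesis
    using exA exB by (simp add: words_inf_both_def infinite_nat_iff_unbounded_le)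
qed

lemma p\<^sub>b_sigma_fixed_point:
  assumes "k \<ge> 1" "m \<ge> 1" and w: "fixed_point_from (sigma k l m) A w" and "n \<ge> 1"
  shows "int (p\<^sub>b w n)
    = int m * int (p\<^sub>a w n) + (int k + int l + 1 - int m) * int n + int m - int l - 1"
proof -
  define i where "i = p\<^sub>a w n"
  define j where "j = length (concat (map (sigma k l m) (stake i w))) + k"
  have inf: "infinite {i. w !! i = A}" "infinite {i. w !! i = B}"
    using sigma_fixed_point_in_words_inf_both[OF assms(1-3)] by (auto simp: words_inf_both_def)
  have i: "w !! i = A" "count_list (stake i w) A = n - 1"
    using nth_occ_pos[OF inf(1)] count_list_stake_occ_pos[OF inf(1)] by (simp_all add: i_def)
  have j: "w !! j = B" "count_list (stake j w) B = n - 1"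
    using sigma_image_of_A[OF assms(2) w i(1)] i(2) by (simp_all add: j_def)
  have "p\<^sub>b w n = j"
    using occ_pos_count_list_stake[OF inf(2) j(1)] j(2) assms(4) by simp
  moreover have "int j
      = (int k + int l + 1) * (int n - 1) + int m * int (count_list (stake i w) B) + int k"
    unfolding j_def length_concat_map_sigma i(2) using assms(4) by (simp add: distrib_right)
  moreover have "int (count_list (stake i w) B) = int i - (int n - 1)"
    using count_list_stake_A_B[of i w] i(2) assms(4) by linarith
  ultimately show ?thesis
    by (simp add: i_def[symmetric] algebra_simps)
qed

section \<open>Uniqueness of the word with the given position function\<close>

lemma occ_pos_ge:
  assumes "infinite {i. w !! i = c}"
  shows "n \<le> Suc (occ_pos c w n)"
  using le_enumerate[OF assms, of "n - 1"] by (simp add: occ_pos_def)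

lemma p\<^sub>a_less_p\<^sub>b_if_formula:
  assumes "k \<ge> 1" "m \<ge> 1" "w \<in> \<W>" "n \<ge> 1"
    and eq: "int (p\<^sub>b w n)
      = int m * int (p\<^sub>a w n) + (int k + int l + 1 - int m) * int n + int m - int l - 1"
  shows "p\<^sub>a w n < p\<^sub>b w n"
proof -
  \<comment> \<open>\<open>d\<close> is the number of \<open>B\<close>s before the
    \<open>n\<close>-th \<open>A\<close>. Written in \<open>d\<close> and \<open>n - 1\<close>, the
    formula has only nonnegative coefficients and can be compared term by term with
    \<open>p\<^sub>a w n\<close>, which is \<open>d + (n - 1)\<close>; the summand \<open>k\<close>
    makes the inequality strict.\<close>
  define d where "d = int (p\<^sub>a w n) - (int n - 1)"
  have "d \<ge> 0"
    using occ_pos_ge[of w A n] assms(3) by (simp add: d_def words_inf_both_def)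
  have "int (p\<^sub>b w n) = int m * d + (int k + int l + 1) * (int n - 1) + int k"
    using eq by (simp add: d_def algebra_simps)
  moreover have "1 * d \<le> int m * d"
    using assms(2) \<open>d \<ge> 0\<close> by (intro mult_right_mono) auto
  moreover have "1 * (int n - 1) \<le> (int k + int l + 1) * (int n - 1)"
    using assms(4) by (intro mult_right_mono) auto
  ultimately show ?thesis using assms(1) by (simp add: d_def)
qed

lemma word_determined_by_p\<^sub>b_of_p\<^sub>a:
  assumes v: "v \<in> \<W>" "\<And>n. n \<ge> 1 \<Longrightarrow> p\<^sub>b v n = f n (p\<^sub>a v n)" "\<And>n. n \<ge> 1 \<Longrightarrow> p\<^sub>a v n < p\<^sub>b v n"
    and w: "w \<in> \<W>" "\<And>n. n \<ge> 1 \<Longrightarrow> p\<^sub>b w n = f n (p\<^sub>a w n)" "\<And>n. n \<ge> 1 \<Longrightarrow> p\<^sub>a w n < p\<^sub>b w n"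
  shows "v = w"
proof -
  \<comment> \<open>This is one half of the induction step, for arbitrary \<open>x\<close> and
    \<open>y\<close> so that it applies in both directions.\<close>
  have transfer: "y !! i = B"
    if x: "x \<in> \<W>" "\<And>n. n \<ge> 1 \<Longrightarrow> p\<^sub>b x n = f n (p\<^sub>a x n)" "\<And>n. n \<ge> 1 \<Longrightarrow> p\<^sub>a x n < p\<^sub>b x n"
      and y: "y \<in> \<W>" "\<And>n. n \<ge> 1 \<Longrightarrow> p\<^sub>b y n = f n (p\<^sub>a y n)"
      and agree: "\<And>j. j < i \<Longrightarrow> x !! j = y !! j" and "x !! i = B" for x y i
  proof -
    have infx: "infinite {i. x !! i = A}" "infinite {i. x !! i = B}"
      and infy: "infinite {i. y !! i = A}" "infinite {i. y !! i = B}"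
      using x(1) y(1) by (auto simp: words_inf_both_def)
    define n where "n = Suc (count_list (stake i x) B)"
    have "p\<^sub>b x n = i" unfolding n_def by (rule occ_pos_count_list_stake[OF infx(2) \<open>x !! i = B\<close>])
    define j where "j = p\<^sub>a x n"
    have "j < i" using x(3)[of n] \<open>p\<^sub>b x n = i\<close> by (simp add: j_def n_def)
    \<comment> \<open>The \<open>n\<close>-th \<open>A\<close> of \<open>x\<close> lies at
      \<open>j\<close>, inside the common prefix, so it is the \<open>n\<close>-th \<open>A\<close>
      of \<open>y\<close> as well; \<open>f\<close> then puts the \<open>n\<close>-th
      \<open>B\<close> of both words at \<open>i\<close>.\<close>
    have "stake j y = stake j x"
      by (rule nth_equalityI) (use agree \<open>j < i\<close> in auto)
    then have "count_list (stake j y) A = n - 1"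
      using count_list_stake_occ_pos[OF infx(1), of n] by (simp add: j_def)
    moreover have "y !! j = A"
      using agree[OF \<open>j < i\<close>] nth_occ_pos[OF infx(1), of n] by (simp add: j_def)
    ultimately have "p\<^sub>a y n = j"
      using occ_pos_count_list_stake[OF infy(1), of j] by (simp add: n_def)
    then have "p\<^sub>b y n = i"
      using x(2)[of n] y(2)[of n] \<open>p\<^sub>b x n = i\<close> by (simp add: j_def n_def)
    then show ?thesis using nth_occ_pos[OF infy(2), of n] by simp
  qed
  have "v !! i = w !! i" for i
  proof (induction i rule: less_induct)
    case (less i)
    have "v !! i = B \<longleftrightarrow> w !! i = B"
      using transfer[OF v w(1,2), of i] transfer[OF w v(1,2), of i] less by metis
    then show ?case by (cases "v !! i"; cases "w !! i") auto
  qed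
  then show ?thesis by (metis stream.map_cong0 stream_smap_nats)
qed

theorem theorem4p20:
  fixes k l m :: nat and w :: "letter stream"
  assumes "k \<ge> 1" and "m \<ge> 1"
    and "fixed_point_from (sigma k l m) A w"
  shows "(\<forall>n\<ge>1. int (p\<^sub>b w n)
            = int m * int (p\<^sub>a w n) + (int k + int l + 1 - int m) * int n + int m - int l - 1)
    \<and> (\<forall>n\<ge>1. rel_pos w n
            = (int m - 1) * int (p\<^sub>a w n) + (int k + int l + 1 - int m) * int n + int m - int l - 1)
    \<and> (\<forall>w'. (w' \<in> \<W> \<and> (\<forall>n\<ge>1. rel_pos w' n
            = (int m - 1) * int (p\<^sub>a w' n) + (int k + int l + 1 - int m) * int n + int m - int l - 1))
          \<longleftrightarrow> w' = w)"
proof -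
  \<comment> \<open>\<open>F\<close> is integer-valued because the coefficient of \<open>n\<close>
    can be negative.\<close>
  define F where "F n p = int m * int p + (int k + int l + 1 - int m) * int n + int m - int l - 1"
    for n p :: nat
  \<comment> \<open>Adding \<open>p\<^sub>a v n\<close> to both sides turns the relative formula
    into the one for \<open>p\<^sub>b v n\<close>.\<close>
  have rel: "rel_pos v n
      = (int m - 1) * int (p\<^sub>a v n) + (int k + int l + 1 - int m) * int n + int m - int l - 1
    \<longleftrightarrow> int (p\<^sub>b v n) = F n (p\<^sub>a v n)" for v n
    by (simp add: rel_pos_def F_def algebra_simps)
  have W: "w \<in> \<W>"
    by (rule sigma_fixed_point_in_words_inf_both[OF assms])
  have F_w: "int (p\<^sub>b w n) = F n (p\<^sub>a w n)" if "n \<ge> 1" for n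
    unfolding F_def by (rule p\<^sub>b_sigma_fixed_point[OF assms that])
  have less: "p\<^sub>a v n < p\<^sub>b v n" if "v \<in> \<W>" "n \<ge> 1" "int (p\<^sub>b v n) = F n (p\<^sub>a v n)" for v n
    using p\<^sub>a_less_p\<^sub>b_if_formula[OF assms(1,2) that(1,2)] that(3) by (simp add: F_def)
  have unique: "w' = w" if w': "w' \<in> \<W>" "\<And>n. n \<ge> 1 \<Longrightarrow> int (p\<^sub>b w' n) = F n (p\<^sub>a w' n)" for w'
  \<comment> \<open>Truncation by \<open>nat\<close> is harmless here: at the arguments that occur,
    \<open>F\<close> equals a position and so is nonnegative.\<close>
  proof (rule word_determined_by_p\<^sub>b_of_p\<^sub>a[where f = "\<lambda>n p. nat (F n p)"])
    show "p\<^sub>b w' n = nat (F n (p\<^sub>a w' n))" if "n \<ge> 1" for n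
      using w'(2)[OF that] by (metis nat_int)
    show "p\<^sub>b w n = nat (F n (p\<^sub>a w n))" if "n \<ge> 1" for n
      using F_w[OF that] by (metis nat_int)
  qed (use w' W F_w less in auto)
  show ?thesis
    unfolding rel F_def[symmetric] using F_w unique W by blast
qed

end
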